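(* Let $d\in\mathbb{N}$, let $H$ be a Hilbert space, let $K:\mathbb{F}_d^+\times\mathbb{F}_d^+\to\mathcal{L}(H)$ be a moment kernel with $K^{(1)}:=K-\Sigma K\ge0$, and let $K=K_{\mathrm{pure}}+K_{\mathrm{unitary}}$ be its Wold decomposition. Let $(\mathcal{K},S,W,P)$ be the minimal Cuntz dilation of $K$, with cyclic subspace $\mathcal{M}:=\overline{\mathrm{span}}\{(S^\gamma)^*Wu:\gamma\in\mathbb{F}_d^+,u\in H\}$, and define the completely positive map $T(X):=\sum_{i=1}^dS_iXS_i^*$. Then for every $N\ge0$, $$(\Sigma^NK)(\alpha,\beta)=W^*S^\alpha T^N(P)(S^\beta)^*W,\qquad\alpha,\beta\in\mathbb{F}_d^+.$$ The limit $K_{\mathrm{unitary}}(\alpha,\beta)=\lim_N(\Sigma^NK)(\alpha,\beta)$ is realized through the strong-operator limit of the sequence $T^N(P)$ on the cyclic subspace $\mathcal{M}$. Defining $$\langle y,P_\infty y\rangle:=\lim_{N\to\infty}\langle y,T^N(P)y\rangle,\qquad y\in\mathcal{M},$$ gives a well-defined positive contraction $P_\infty$ on $\mathcal{M}$ satisfying, for all $\alpha,\beta\in\mathbb{F}_d^+$, $$K_{\mathrm{unitary}}(\alpha,\beta)=W^*S^\alpha P_\infty(S^\beta)^*W,\qquad K_{\mathrm{pure}}(\alpha,\beta)=W^*S^\alpha(P-P_\infty)(S^\beta)^*W.$$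
   Context: $\mathbb{F}_d^+$ is the free semigroup on $\{1,\dots,d\}$ with neutral element $\emptyset$. For a tuple $S$ and a word $\alpha=i_1\cdots i_k$, $S^\alpha:=S_{i_1}\cdots S_{i_k}$, $S^\emptyset:=I$. A moment kernel is a kernel $K(\alpha,\beta)=\mathbb{E}[A^\alpha(A^\beta)^*]$ (weak sense) for a $d$-tuple $A$ of strongly measurable random operators $A_i:\Omega\to\mathcal{L}(H)$ over a probability space with $\mathbb{E}[\|A^\alpha\|^2]<\infty$ for all $\alpha$. A kernel $K:\mathbb{F}_d^+\times\mathbb{F}_d^+\to\mathcal{L}(H)$ is positive definite, written $K\ge0$, if $\sum_{i,j}\langle u_i,K(\alpha_i,\alpha_j)u_j\rangle\ge0$ for every finite family $\{(\alpha_j,u_j)\}\subset\mathbb{F}_d^+\times H$. The free shift is $(\Sigma K)(\alpha,\beta):=\sum_{i=1}^dK(\alpha i,\beta i)$. Wold decomposition: $K_{\mathrm{pure}},K_{\mathrm{unitary}}$ are the unique positive definite kernels with $K=K_{\mathrm{pure}}+K_{\mathrm{unitary}}$, $\Sigma K_{\mathrm{unitary}}=K_{\mathrm{unitary}}$, and $\Sigma^NK_{\mathrm{pure}}\to0$ point-weakly (i.e. $\langle u,(\Sigma^NK_{\mathrm{pure}})(\alpha,\beta)v\rangle\to0$ for all $\alpha,\beta,u,v$); moreover $K_{\mathrm{unitary}}(\alpha,\beta)=\lim_N(\Sigma^NK)(\alpha,\beta)$ point-weakly. Minimal Cuntz dilation: $\mathcal{K}$ is a Hilbert space, $S=(S_1,\dots,S_d)$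 a Cuntz family on $\mathcal{K}$ ($S_i^*S_j=\delta_{i,j}I$, $\sum_iS_iS_i^*=I$), $W:H\to\mathcal{K}$ an isometry, $P$ an orthogonal projection on $\mathcal{K}$ with $K(\alpha,\beta)=W^*S^\alpha P(S^\beta)^*W$ for all $\alpha,\beta$ and $\sum_iS_iPS_i^*\le P$ on $\mathcal{M}$ (i.e. $\langle y,\sum_iS_iPS_i^*y\rangle\le\langle y,Py\rangle$ for $y\in\mathcal{M}$); minimality means that $\mathcal{K}$ is the closed span of $\{S^\alpha P_n(S^\beta)^*Wu:\alpha,\beta\in\mathbb{F}_d^+,\ n\in\{0,1\},\ u\in H\}$, where $P_0=P$ and $P_1=P-\sum_iS_iPS_i^*$. *)

theory Defs
  imports "HOL-Probability.Probability" "HOL-Library.Complex_Order"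
begin

section \<open>Complex Hilbert spaces\<close>

text \<open>
  The libraries only know real inner product spaces, so a complex Hilbert space is a complete
  \<^class>\<open>real_inner\<close> space with a compatible complex structure: norm and topology are those of
  \<^class>\<open>real_inner\<close>, whose inner product is the real part of the complex one. The complex inner
  product is linear in its second argument.
\<close>

class chilbert_space = real_inner + complete_space +
  fixes scaleC :: "complex \<Rightarrow> 'a \<Rightarrow> 'a"  (infixr \<open>*\<^sub>C\<close> 75)
    and cinner :: "'a \<Rightarrow> 'a \<Rightarrow> complex"
  assumes scaleC_add_right: "c *\<^sub>C (x + y) = c *\<^sub>C x + c *\<^sub>C y"
    and scaleC_add_left: "(b + c) *\<^sub>C x = b *\<^sub>C x + c *\<^sub>C x"
    and scaleC_scaleC: "b *\<^sub>C (c *\<^sub>C x) = (b * c) *\<^sub>C x"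
    and scaleC_of_real: "complex_of_real r *\<^sub>C x = r *\<^sub>R x"
    and cinner_commute: "cinner x y = cnj (cinner y x)"
    and cinner_add_right: "cinner x (y + z) = cinner x y + cinner x z"
    and cinner_scaleC_right: "cinner x (c *\<^sub>C y) = c * cinner x y"
    and Re_cinner: "Re (cinner x y) = inner x y"

global_interpretation complex_vector: vector_space "scaleC :: complex \<Rightarrow> 'a \<Rightarrow> 'a::chilbert_space"
proof
  show "1 *\<^sub>C x = x" for x :: 'a
    using scaleC_of_real[of 1 x] by simp
qed (simp_all add: scaleC_add_right scaleC_add_left scaleC_scaleC)

instantiation complex :: chilbert_space
begin

definition scaleC_complex :: "complex \<Rightarrow> complex \<Rightarrow> complex"
  where "scaleC_complex c x = c * x"

definition cinner_complex :: "complex \<Rightarrow> complex \<Rightarrow> complex"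
  where "cinner_complex x y = cnj x * y"

instance
  by standard
    (auto simp: scaleC_complex_def cinner_complex_def inner_complex_def scaleR_conv_of_real algebra_simps)

end


section \<open>Bounded operators\<close>

text \<open>
  \<^typ>\<open>'a \<Rightarrow>\<^sub>L 'b\<close> consists of the bounded real-linear maps; the operators between complex Hilbert
  spaces are those satisfying \<open>clin\<close>.
\<close>

definition clin :: "('a::chilbert_space \<Rightarrow>\<^sub>L 'b::chilbert_space) \<Rightarrow> bool"
  where "clin X \<longleftrightarrow> (\<forall>c x. X (c *\<^sub>C x) = c *\<^sub>C X x)"

definition adj :: "('a::chilbert_space \<Rightarrow>\<^sub>L 'b::chilbert_space) \<Rightarrow> 'b \<Rightarrow>\<^sub>L 'a"
  where "adj X = (THE Y :: 'b \<Rightarrow>\<^sub>L 'a. \<forall>x y. cinner (Y y) x = cinner y (X x))"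

definition orth_projection :: "('a::chilbert_space \<Rightarrow>\<^sub>L 'a) \<Rightarrow> bool"
  where "orth_projection X \<longleftrightarrow> clin X \<and> X o\<^sub>L X = X \<and> adj X = X"

definition proj_onto :: "'a::chilbert_space set \<Rightarrow> 'a \<Rightarrow>\<^sub>L 'a"
  where "proj_onto V = (THE Q. orth_projection Q \<and> range (blinfun_apply Q) = V)"

text \<open>
  The bounded operators on a closed subspace \<open>V\<close> are represented by the operators on the whole space
  that map into \<open>V\<close> and vanish on the orthogonal complement of \<open>V\<close>, i.e. that are fixed by
  compression to \<open>V\<close>. This is an isometric identification. An operator that does not leave \<open>V\<close>
  invariant is regarded as an operator on \<open>V\<close> through its compression, which has the same quadratic
  form on \<open>V\<close>.
\<close>

definition compress :: "'a::chilbert_space set \<Rightarrow> ('a \<Rightarrow>\<^sub>L 'a) \<Rightarrow> 'a \<Rightarrow>\<^sub>L 'a"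
  where "compress V X = proj_onto V o\<^sub>L X o\<^sub>L proj_onto V"

definition operator_on :: "'a::chilbert_space set \<Rightarrow> ('a \<Rightarrow>\<^sub>L 'a) \<Rightarrow> bool"
  where "operator_on V X \<longleftrightarrow> clin X \<and> compress V X = X"

definition completely_positive ::
    "(('a::chilbert_space \<Rightarrow>\<^sub>L 'a) \<Rightarrow> ('b::chilbert_space \<Rightarrow>\<^sub>L 'b)) \<Rightarrow> bool"
  where "completely_positive F \<longleftrightarrow>
    (\<forall>X. clin X \<longrightarrow> clin (F X)) \<and>
    (\<forall>X Y. clin X \<longrightarrow> clin Y \<longrightarrow> F (X + Y) = F X + F Y) \<and>
    (\<forall>c X Y. clin X \<longrightarrow> (\<forall>x. blinfun_apply Y x = c *\<^sub>C blinfun_apply X x) \<longrightarrow>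
       (\<forall>y. blinfun_apply (F Y) y = c *\<^sub>C blinfun_apply (F X) y)) \<and>
    (\<forall>(n::nat) X. (\<forall>i<n. \<forall>j<n. clin (X i j)) \<longrightarrow>
       (\<forall>x. 0 \<le> (\<Sum>i<n. \<Sum>j<n. cinner (x i) (X i j (x j)))) \<longrightarrow>
       (\<forall>y. 0 \<le> (\<Sum>i<n. \<Sum>j<n. cinner (y i) (F (X i j) (y j)))))"


section \<open>Kernels on the free semigroup\<close>

text \<open>
  The free semigroup on \<open>d\<close> letters is \<^typ>\<open>'d list\<close> for a finite type \<^typ>\<open>'d\<close> with \<open>d\<close> elements.
\<close>

fun word_op :: "('d \<Rightarrow> 'a::chilbert_space \<Rightarrow>\<^sub>L 'a) \<Rightarrow> 'd list \<Rightarrow> 'a \<Rightarrow>\<^sub>L 'a"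
  where
    "word_op S [] = id_blinfun"
  | "word_op S (i # \<alpha>) = S i o\<^sub>L word_op S \<alpha>"

type_synonym ('d, 'a) kernel = "'d list \<Rightarrow> 'd list \<Rightarrow> 'a \<Rightarrow>\<^sub>L 'a"

definition pos_def_kernel :: "('d, 'a::chilbert_space) kernel \<Rightarrow> bool"
  where "pos_def_kernel K \<longleftrightarrow> (\<forall>\<alpha> \<beta>. clin (K \<alpha> \<beta>)) \<and>
    (\<forall>(n::nat) w u. 0 \<le> (\<Sum>i<n. \<Sum>j<n. cinner (u i) (K (w i) (w j) (u j))))"

definition free_shift :: "('d::finite, 'a::chilbert_space) kernel \<Rightarrow> ('d, 'a) kernel"
  where "free_shift K = (\<lambda>\<alpha> \<beta>. \<Sum>i\<in>UNIV. K (\<alpha> @ [i]) (\<beta> @ [i]))"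

definition strongly_measurable :: "'w measure \<Rightarrow> ('w \<Rightarrow> 'a::topological_space) \<Rightarrow> bool"
  where "strongly_measurable M f \<longleftrightarrow>
    (\<exists>s. (\<forall>n::nat. simple_function M (s n)) \<and> (AE \<omega> in M. (\<lambda>n. s n \<omega>) \<longlonglongrightarrow> f \<omega>))"

text \<open>
  A random operator is strongly measurable if its orbits are strongly measurable vector-valued
  functions; the expectation is taken in the weak sense.
\<close>

definition moment_kernel ::
    "'w measure \<Rightarrow> ('d \<Rightarrow> 'w \<Rightarrow> 'a::chilbert_space \<Rightarrow>\<^sub>L 'a) \<Rightarrow> ('d, 'a) kernel \<Rightarrow> bool"
  where "moment_kernel M A K \<longleftrightarrow> prob_space M \<and>
    (\<forall>i. \<forall>\<omega>\<in>space M. clin (A i \<omega>)) \<and>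
    (\<forall>i u. strongly_measurable M (\<lambda>\<omega>. A i \<omega> u)) \<and>
    (\<forall>\<alpha>. integrable M (\<lambda>\<omega>. (norm (word_op (\<lambda>i. A i \<omega>) \<alpha>))\<^sup>2)) \<and>
    (\<forall>\<alpha> \<beta>. clin (K \<alpha> \<beta>)) \<and>
    (\<forall>\<alpha> \<beta> u v. has_bochner_integral M
       (\<lambda>\<omega>. cinner u ((word_op (\<lambda>i. A i \<omega>) \<alpha> o\<^sub>L adj (word_op (\<lambda>i. A i \<omega>) \<beta>)) v))
       (cinner u (K \<alpha> \<beta> v)))"

definition wold_decomposition ::
    "('d::finite, 'a::chilbert_space) kernel \<Rightarrow> ('d, 'a) kernel \<Rightarrow> ('d, 'a) kernel \<Rightarrow> bool"
  where "wold_decomposition K K_pure K_unitary \<longleftrightarrow>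
    pos_def_kernel K_pure \<and> pos_def_kernel K_unitary \<and>
    (\<forall>\<alpha> \<beta>. K \<alpha> \<beta> = K_pure \<alpha> \<beta> + K_unitary \<alpha> \<beta>) \<and>
    free_shift K_unitary = K_unitary \<and>
    (\<forall>\<alpha> \<beta> u v. (\<lambda>N. cinner u ((free_shift ^^ N) K_pure \<alpha> \<beta> v)) \<longlonglongrightarrow> 0)"


section \<open>Minimal Cuntz dilations\<close>

definition cuntz_family :: "('d::finite \<Rightarrow> 'k::chilbert_space \<Rightarrow>\<^sub>L 'k) \<Rightarrow> bool"
  where "cuntz_family S \<longleftrightarrow> (\<forall>i. clin (S i)) \<and>
    (\<forall>i j. adj (S i) o\<^sub>L S j = (if i = j then id_blinfun else 0)) \<and>
    (\<Sum>i\<in>UNIV. S i o\<^sub>L adj (S i)) = id_blinfun"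

definition cuntz_map ::
    "('d::finite \<Rightarrow> 'k::chilbert_space \<Rightarrow>\<^sub>L 'k) \<Rightarrow> ('k \<Rightarrow>\<^sub>L 'k) \<Rightarrow> 'k \<Rightarrow>\<^sub>L 'k"
  where "cuntz_map S X = (\<Sum>i\<in>UNIV. S i o\<^sub>L X o\<^sub>L adj (S i))"

definition cyclic_subspace ::
    "('d \<Rightarrow> 'k::chilbert_space \<Rightarrow>\<^sub>L 'k) \<Rightarrow> ('a::chilbert_space \<Rightarrow>\<^sub>L 'k) \<Rightarrow> 'k set"
  where "cyclic_subspace S W =
    closure (complex_vector.span {adj (word_op S \<gamma>) (W u) | \<gamma> u. True})"

definition minimal_cuntz_dilation ::
    "('d::finite, 'a::chilbert_space) kernel \<Rightarrow> ('d \<Rightarrow> 'k::chilbert_space \<Rightarrow>\<^sub>L 'k) \<Rightarrow>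
     ('a \<Rightarrow>\<^sub>L 'k) \<Rightarrow> ('k \<Rightarrow>\<^sub>L 'k) \<Rightarrow> bool"
  where "minimal_cuntz_dilation K S W P \<longleftrightarrow>
    cuntz_family S \<and>
    clin W \<and> (\<forall>u. norm (W u) = norm u) \<and>
    orth_projection P \<and>
    (\<forall>\<alpha> \<beta>. K \<alpha> \<beta> = adj W o\<^sub>L word_op S \<alpha> o\<^sub>L P o\<^sub>L adj (word_op S \<beta>) o\<^sub>L W) \<and>
    (\<forall>y\<in>cyclic_subspace S W. cinner y (cuntz_map S P y) \<le> cinner y (P y)) \<and>
    closure (complex_vector.span
      {word_op S \<alpha> (blinfun_apply X (adj (word_op S \<beta>) (W u))) | \<alpha> \<beta> X u. X \<in> {P, P - cuntz_map S P}}) = UNIV"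

end

(* The free shift of the kernel W* S^a X (S^b)* W is the kernel of the same form with T(X) in place
   of X, which gives the dilation formula for all iterates. Since M is invariant under every S_i*,
   the inequality T(P) <= P on M propagates to T^(N+1)(P) <= T^N(P) on M. Hence the compressions of
   T^N(P) to M form a decreasing sequence of positive contractions, which converges strongly; its
   limit is P_inf, and the vectors (S^b)* W u lie in M, so the limit passes through the dilation
   formula. *)

theory Submission
  imports Defs
begin

section \<open>Complex inner products\<close>

text \<open>The iterates need not map M into itself, and T(P) <= P is given only as an inequality of
  quadratic forms on M. Monotone convergence therefore applies to the compressions Q T^N(P) Q, with
  Q the projection onto M: their forms at x are those of the iterates at Qx, so inequalities on M
  become inequalities on the whole space. \<open>adj\<close> and \<open>proj_onto\<close> are
  definite descriptions, so existence and uniqueness must come first. One Riesz theorem on closed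
  subspaces yields both: on the whole space it gives adjoints, on a closed complex subspace the
  projection. The limit theorem needs only the real inner product; complex linearity of the limit is
  recovered afterwards. Complex polarization is what lets the quadratic form on M determine
  P_inf.\<close>

lemma cinner_add_left: "cinner (x + y) z = cinner x z + cinner y z"
  by (metis cinner_add_right cinner_commute complex_cnj_add)

lemma cinner_scaleC_left: "cinner (c *\<^sub>C x) y = cnj c * cinner x y"
  by (metis cinner_commute cinner_scaleC_right complex_cnj_mult)

lemma scaleC_scaleR: "c *\<^sub>C (r *\<^sub>R x) = r *\<^sub>R (c *\<^sub>C (x :: 'a::chilbert_space))"
proof -
  have "c *\<^sub>C (r *\<^sub>R x) = c *\<^sub>C (complex_of_real r *\<^sub>C x)"
    by (simp only: scaleC_of_real)
  also have "\<dots> = complex_of_real r *\<^sub>C (c *\<^sub>C x)"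
    by (simp only: scaleC_scaleC mult.commute)
  finally show ?thesis
    by (simp only: scaleC_of_real)
qed

text \<open>Antilinearity on the left turns the imaginary part into the real part at
  \<open>\<i> *\<^sub>C x\<close>. Real facts about \<open>inner\<close> thus transfer to
  \<open>cinner\<close>.\<close>

lemma cinner_conv_inner: "cinner x y = Complex (inner x y) (inner (\<i> *\<^sub>C x) y)"
proof (rule complex_eqI)
  have "Re (cinner (\<i> *\<^sub>C x) y) = Im (cinner x y)"
    by (simp add: cinner_scaleC_left)
  then show "Im (cinner x y) = Im (Complex (inner x y) (inner (\<i> *\<^sub>C x) y))"
    by (simp add: Re_cinner)
qed (simp add: Re_cinner)

lemma Im_cinner: "Im (cinner x y) = - inner x (\<i> *\<^sub>C y)"
proof -
  have "Re (cinner x (\<i> *\<^sub>C y)) = - Im (cinner x y)"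
    by (simp add: cinner_scaleC_right)
  then show ?thesis
    by (simp add: Re_cinner)
qed

lemma bounded_linear_cinner_right: "bounded_linear (cinner x)"
proof -
  have "cinner x = (\<lambda>y. of_real (inner x y) + \<i> * of_real (inner (\<i> *\<^sub>C x) y))"
    by (simp add: fun_eq_iff cinner_conv_inner complex_eq_iff)
  then show ?thesis
    by (auto intro!: bounded_linear_intros bounded_linear_add
        bounded_linear_const_mult bounded_linear_compose[OF bounded_linear_of_real])
qed

lemmas cinner_zero_right = linear_0[OF bounded_linear.linear, OF bounded_linear_cinner_right]
  and cinner_diff_right = linear_diff[OF bounded_linear.linear, OF bounded_linear_cinner_right]
  and cinner_sum_right = linear_sum[OF bounded_linear.linear, OF bounded_linear_cinner_right]
  and tendsto_cinner_right = bounded_linear.tendsto[OF bounded_linear_cinner_right]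

lemma cinner_extR:
  assumes "\<And>x. cinner x y = cinner x z"
  shows "y = z"
  using vector_eq_ldot[of y z] assms by (simp flip: Re_cinner)

lemma cinner_extL:
  assumes "\<And>x. cinner y x = cinner z x"
  shows "y = z"
  using vector_eq_rdot[of y z] assms by (simp flip: Re_cinner)

text \<open>The class axioms do not mention the norm of a complex multiple. It is recovered from
  \<open>cinner z z\<close>, which is real by conjugate symmetry and hence equals the squared
  norm.\<close>

lemma norm_scaleC: "norm (c *\<^sub>C x) = cmod c * norm (x :: 'a::chilbert_space)"
proof -
  have "complex_of_real ((norm (c *\<^sub>C x))\<^sup>2) = cinner (c *\<^sub>C x) (c *\<^sub>C x)" for c and x :: 'a
    using cinner_commute[of "c *\<^sub>C x" "c *\<^sub>C x"]
    by (simp add: complex_eq_iff power2_norm_eq_inner Re_cinner)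
  note norm_sq = this
  \<comment> \<open>The factor 1 gives the right-hand side the shape of \<open>norm_sq\<close>,
    which is used backwards next.\<close>
  have "complex_of_real ((norm (c *\<^sub>C x))\<^sup>2) = (cnj c * c) * cinner (1 *\<^sub>C x) (1 *\<^sub>C x)"
    unfolding norm_sq by (simp add: cinner_scaleC_left cinner_scaleC_right mult.assoc)
  also have "\<dots> = complex_of_real ((cmod c * norm x)\<^sup>2)"
    unfolding norm_sq[symmetric] by (simp add: power_mult_distrib mult.commute flip: complex_norm_square)
  finally have "(norm (c *\<^sub>C x))\<^sup>2 = (cmod c * norm x)\<^sup>2"
    by (simp only: of_real_eq_iff)
  then show ?thesis
    by (simp add: power2_eq_iff_nonneg)
qed

lemma bounded_linear_scaleC: "bounded_linear ((*\<^sub>C) c :: 'a::chilbert_space \<Rightarrow> 'a)"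
  by (rule bounded_linear_intro[where K = "cmod c"])
    (simp_all add: scaleC_add_right scaleC_scaleR norm_scaleC mult.commute)

lemma csubspace_scaleR:
  assumes "complex_vector.subspace V" and "x \<in> V"
  shows "r *\<^sub>R x \<in> V"
  using complex_vector.subspace_scale[OF assms, of "complex_of_real r"] by (simp add: scaleC_of_real)

lemma subspace_if_csubspace:
  assumes "complex_vector.subspace V"
  shows "subspace V"
  by (rule subspaceI)
    (simp_all add: assms complex_vector.subspace_0 complex_vector.subspace_add csubspace_scaleR)

lemma csubspace_closure:
  assumes V: "complex_vector.subspace V"
  shows "complex_vector.subspace (closure V)"
proof (rule complex_vector.subspaceI)
  show "0 \<in> closure V"
    using closure_subset complex_vector.subspace_0[OF V] by blast
  show "x + y \<in> closure V" if x: "x \<in> closure V" and y: "y \<in> closure V" for x y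
  proof -
    obtain f g where f: "\<And>n. f n \<in> V" "f \<longlonglongrightarrow> x" and g: "\<And>n. g n \<in> V" "g \<longlonglongrightarrow> y"
      using x y unfolding closure_sequential by blast
    have "(\<lambda>n. f n + g n) \<longlonglongrightarrow> x + y"
      by (intro tendsto_add f g)
    moreover have "f n + g n \<in> V" for n
      by (intro complex_vector.subspace_add[OF V] f g)
    ultimately show ?thesis
      unfolding closure_sequential by (intro exI[of _ "\<lambda>n. f n + g n"]) simp
  qed
  show "c *\<^sub>C x \<in> closure V" if x: "x \<in> closure V" for c x
  proof -
    obtain f where f: "\<And>n. f n \<in> V" "f \<longlonglongrightarrow> x"
      using x unfolding closure_sequential by blast
    have "(\<lambda>n. c *\<^sub>C f n) \<longlonglongrightarrow> c *\<^sub>C x"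
      by (rule bounded_linear.tendsto[OF bounded_linear_scaleC f(2)])
    moreover have "c *\<^sub>C f n \<in> V" for n
      by (intro complex_vector.subspace_scale[OF V] f)
    ultimately show ?thesis
      unfolding closure_sequential by (intro exI[of _ "\<lambda>n. c *\<^sub>C f n"]) simp
  qed
qed


section \<open>Riesz representation\<close>

text \<open>The representing vector minimizes \<open>\<parallel>x\<parallel>\<^sup>2 - 2 f x\<close>; the parallelogram law makes every
  minimizing sequence a Cauchy sequence.\<close>

lemma riesz_representation:
  fixes V :: "'a::{real_inner, complete_space} set"
  assumes V: "subspace V" "closed V" and f: "bounded_linear f"
  shows "\<exists>v\<in>V. \<forall>x\<in>V. inner v x = f x"
proof -
  interpret f: bounded_linear f by fact
  obtain B where B: "\<And>x. \<bar>f x\<bar> \<le> norm x * B"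
    using f.bounded by auto
  define g where "g x = (norm x)\<^sup>2 - 2 * f x" for x
  have lower: "- B\<^sup>2 \<le> g x" for x
  proof -
    have "0 \<le> (norm x - B)\<^sup>2" by simp
    moreover have "f x \<le> norm x * B" using B[of x] by simp
    ultimately show ?thesis by (simp add: g_def power2_diff)
  qed
  define m where "m = Inf (g ` V)"
  have bdd: "bdd_below (g ` V)"
    using lower by (auto simp: bdd_below_def)
  have ne: "V \<noteq> {}"
    using V(1) subspace_0 by auto
  have m_le: "m \<le> g x" if "x \<in> V" for x
    unfolding m_def using that bdd by (simp add: cINF_lower)
  have "\<exists>x\<in>V. g x < m + 1 / Suc n" for n
    using cINF_less_iff[OF ne bdd, of "m + 1 / Suc n"] by (simp add: m_def)
  then obtain x where xV: "\<And>n. x n \<in> V" and xm: "\<And>n. g (x n) < m + 1 / Suc n"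
    by metis
  \<comment> \<open>The \<open>f\<close>-terms cancel by linearity at the midpoint, which stays in
    \<open>V\<close> and so has value at least \<open>m\<close>.\<close>
  have parallelogram: "(norm (a - b))\<^sup>2 = 2 * g a + 2 * g b - 4 * g ((1/2) *\<^sub>R (a + b))" for a b
    unfolding g_def power2_norm_eq_inner
    by (simp add: inner_simps f.add f.scaleR inner_commute field_simps)
  have near: "(norm (a - b))\<^sup>2 \<le> 2 * (g a - m) + 2 * (g b - m)" if "a \<in> V" "b \<in> V" for a b
    using m_le[of "(1/2) *\<^sub>R (a + b)"] parallelogram[of a b] that V(1)
    by (simp add: subspace_add subspace_scale)
  have "Cauchy x"
  proof (rule metric_CauchyI)
    fix e :: real assume e: "0 < e"
    obtain N where N: "1 / real (Suc N) < e\<^sup>2 / 4"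
      using nat_approx_posE[of "e\<^sup>2 / 4"] e by auto
    have small: "g (x n) - m < e\<^sup>2 / 4" if "n \<ge> N" for n
    proof -
      have "1 / real (Suc n) \<le> 1 / real (Suc N)"
        using that by (simp add: frac_le)
      then show ?thesis using xm[of n] N by linarith
    qed
    have "dist (x k) (x n) < e" if "k \<ge> N" "n \<ge> N" for k n
    proof -
      have "(norm (x k - x n))\<^sup>2 < e\<^sup>2"
        using near[OF xV xV, of k n] small[OF that(1)] small[OF that(2)]
        by argo
      then show ?thesis
        using e by (simp add: dist_norm power2_less_imp_less)
    qed
    then show "\<exists>N. \<forall>k\<ge>N. \<forall>n\<ge>N. dist (x k) (x n) < e" by blast
  qed
  then obtain v where v: "x \<longlonglongrightarrow> v"
    using Cauchy_convergent convergent_def by blast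
  have vV: "v \<in> V"
    using closed_sequentially[OF V(2)] xV v by blast
  have "(\<lambda>n. g (x n)) \<longlonglongrightarrow> g v"
    unfolding g_def by (intro tendsto_intros f.tendsto v)
  moreover have "(\<lambda>n. m + 1 / Suc n) \<longlonglongrightarrow> m + 0"
    by (intro tendsto_intros LIMSEQ_Suc[OF lim_1_over_n])
  ultimately have gv: "g v \<le> m"
    using LIMSEQ_le[of "\<lambda>n. g (x n)" "g v" "\<lambda>n. m + 1 / Suc n" m] less_imp_le[OF xm] by simp
  have "inner v z = f z" if z: "z \<in> V" for z
  proof (cases "z = 0")
    case False
    \<comment> \<open>This \<open>t\<close> minimizes the quadratic
      \<open>g (v + t *\<^sub>R z)\<close>; the gain is the squared defect over the squared norm of
      \<open>z\<close>, so minimality of \<open>v\<close> forces the defect to vanish.\<close>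
    define t where "t = (f z - inner v z) / (norm z)\<^sup>2"
    have "g v \<le> g (v + t *\<^sub>R z)"
      using gv m_le[of "v + t *\<^sub>R z"] V(1) vV z by (simp add: subspace_add subspace_scale)
    also have "\<dots> = g v - 2 * t * (f z - inner v z) + t\<^sup>2 * (norm z)\<^sup>2"
      unfolding g_def power2_norm_eq_inner
      by (simp add: inner_simps f.add f.scaleR inner_commute algebra_simps power2_eq_square)
    also have "\<dots> = g v - (f z - inner v z)\<^sup>2 / (norm z)\<^sup>2"
      using False by (simp add: t_def field_simps power2_eq_square)
    finally have "(f z - inner v z)\<^sup>2 / (norm z)\<^sup>2 \<le> 0" by simp
    then show ?thesis
      using False by (simp add: divide_le_0_iff)
  qed (simp add: f.zero)
  then show ?thesis using vV by blast
qed


section \<open>Adjoints and orthogonal projections\<close>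

lemma clinD: "clin X \<Longrightarrow> X (c *\<^sub>C x) = c *\<^sub>C X x"
  by (simp add: clin_def)

lemma adj_eqI:
  fixes X :: "'a::chilbert_space \<Rightarrow>\<^sub>L 'b::chilbert_space"
  assumes "\<And>x y. cinner (blinfun_apply Y y) x = cinner y (X x)"
  shows "adj X = Y"
  unfolding adj_def
proof (rule the_equality)
  fix Z assume "\<forall>x y. cinner (blinfun_apply Z y) x = cinner y (X x)"
  with assms show "Z = Y"
    by - (rule blinfun_eqI, rule cinner_extL, simp)
qed (simp add: assms)

text \<open>Riesz gives the real adjoint \<open>h\<close>. Complex linearity of \<open>X\<close>
  makes the imaginary parts agree as well, because these are real inner products with
  \<open>\<i> *\<^sub>C x\<close>; then \<open>adj_eqI\<close> identifies \<open>h\<close> with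
  \<open>adj X\<close>.\<close>

lemma cinner_adj_left:
  fixes X :: "'a::chilbert_space \<Rightarrow>\<^sub>L 'b::chilbert_space"
  assumes X: "clin X"
  shows "cinner (adj X y) x = cinner y (X x)"
proof -
  have "\<exists>z. \<forall>x. inner z x = inner y (X x)" for y
    using riesz_representation[OF subspace_UNIV closed_UNIV
        bounded_linear_compose[OF bounded_linear_inner_right blinfun.bounded_linear_right]]
    by simp
  then obtain h where h: "\<And>x y. inner (h y) x = inner y (X x)"
    by metis
  have "bounded_linear h"
  proof (rule bounded_linear_intro[where K = "norm X"])
    show "h (x + y) = h x + h y" for x y
      by (rule vector_eq_rdot[THEN iffD1]) (simp add: h inner_simps blinfun.bilinear_simps)
    show "h (r *\<^sub>R x) = r *\<^sub>R h x" for r x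
      by (rule vector_eq_rdot[THEN iffD1]) (simp add: h inner_simps blinfun.bilinear_simps)
    show "norm (h y) \<le> norm y * norm X" for y
    proof -
      have "norm (h y) * norm (h y) = inner y (X (h y))"
        using h[of y "h y"] by (simp flip: power2_norm_eq_inner add: power2_eq_square)
      also have "\<dots> \<le> norm y * (norm X * norm (h y))"
        by (meson Cauchy_Schwarz_ineq2 abs_le_D1 mult_left_mono norm_blinfun norm_ge_zero order_trans)
      finally show ?thesis
        by (cases "norm (h y) = 0") (auto simp: mult.assoc mult_le_cancel_right)
    qed
  qed
  then have h_apply: "blinfun_apply (Blinfun h) = h"
    by (rule bounded_linear_Blinfun_apply)
  have "cinner (h y) x = cinner y (X x)" for x y
    by (rule complex_eqI) (simp_all add: Re_cinner Im_cinner h flip: clinD[OF X])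
  then have "adj X = Blinfun h"
    by (intro adj_eqI) (simp add: h_apply)
  then show ?thesis
    using \<open>cinner (h y) x = cinner y (X x)\<close> by (simp add: h_apply)
qed

lemma cinner_adj_right: "clin X \<Longrightarrow> cinner x (adj X y) = cinner (X x) y"
  by (subst (1 2) cinner_commute) (simp add: cinner_adj_left)

lemma inner_adj_left: "clin X \<Longrightarrow> inner (adj X y) x = inner y (X x)"
  by (metis Re_cinner cinner_adj_left)

lemma clin_adj: "clin X \<Longrightarrow> clin (adj X)"
  unfolding clin_def[of "adj X"]
  by (intro allI, rule cinner_extL) (simp add: cinner_adj_left cinner_scaleC_left)

lemma clin_compose: "clin X \<Longrightarrow> clin Y \<Longrightarrow> clin (X o\<^sub>L Y)"
  by (simp add: clin_def)

lemma clin_id: "clin id_blinfun"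
  by (simp add: clin_def)

lemma clin_diff: "clin X \<Longrightarrow> clin Y \<Longrightarrow> clin (X - Y)"
  by (simp add: clin_def blinfun.bilinear_simps complex_vector.scale_right_diff_distrib)

lemma clin_sum: "(\<And>i. i \<in> I \<Longrightarrow> clin (X i)) \<Longrightarrow> clin (\<Sum>i\<in>I. X i)"
  by (simp add: clin_def blinfun.sum_left complex_vector.scale_sum_right)

lemma adj_compose: "clin X \<Longrightarrow> clin Y \<Longrightarrow> adj (X o\<^sub>L Y) = adj Y o\<^sub>L adj X"
  by (rule adj_eqI) (simp add: cinner_adj_left)

lemma orth_projection_cinner: "orth_projection Q \<Longrightarrow> cinner (Q x) y = cinner x (Q y)"
  by (metis cinner_adj_left orth_projection_def)

lemma orth_projection_inner: "orth_projection Q \<Longrightarrow> inner (Q x) y = inner x (Q y)"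
  by (metis Re_cinner orth_projection_cinner)

lemma orth_projection_idem: "orth_projection Q \<Longrightarrow> Q (Q x) = Q x"
  by (metis blinfun_apply_blinfun_compose orth_projection_def)

lemma orth_projection_fixes_range: "orth_projection Q \<Longrightarrow> y \<in> range (blinfun_apply Q) \<Longrightarrow> Q y = y"
  by (auto simp: orth_projection_idem)

lemma orth_projection_norm_sq: "orth_projection Q \<Longrightarrow> inner x (Q x) = (norm (Q x))\<^sup>2"
  by (metis orth_projection_idem orth_projection_inner power2_norm_eq_inner)

lemma orth_projection_norm_le:
  assumes "orth_projection Q"
  shows "norm (Q x) \<le> norm x"
proof -
  have "norm (Q x) * norm (Q x) \<le> norm x * norm (Q x)"
    using orth_projection_norm_sq[OF assms, of x] Cauchy_Schwarz_ineq2[of x "Q x"]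
    by (simp add: power2_eq_square)
  then show ?thesis
    by (cases "norm (Q x) = 0") (auto simp: mult_le_cancel_right)
qed

text \<open>Riesz inside \<open>V\<close>, applied to \<open>inner a\<close>, returns the projection
  of \<open>a\<close>. Linearity then follows from the uniqueness rule \<open>q_eqI\<close>.\<close>

lemma orth_projection_exists:
  assumes V: "complex_vector.subspace V" "closed V"
  shows "\<exists>Q. orth_projection Q \<and> range (blinfun_apply Q) = V"
proof -
  have "\<exists>v\<in>V. \<forall>x\<in>V. inner v x = inner a x" for a
    using riesz_representation[OF subspace_if_csubspace[OF V(1)] V(2), of "inner a"]
    by (simp add: bounded_linear_inner_right)
  then obtain q where qV: "\<And>a. q a \<in> V" and q: "\<And>a x. x \<in> V \<Longrightarrow> inner (q a) x = inner a x"
    by metis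
  note sub = complex_vector.subspace_add[OF V(1)] complex_vector.subspace_scale[OF V(1)]
    csubspace_scaleR[OF V(1)] complex_vector.subspace_diff[OF V(1)]
  have q_eqI: "q a = v" if "v \<in> V" "\<And>x. x \<in> V \<Longrightarrow> inner v x = inner a x" for a v
  proof -
    have "inner (q a - v) (q a - v) = 0"
      using that qV sub by (simp only: inner_diff_left q)
    then show ?thesis by simp
  qed
  have "bounded_linear q"
  proof (rule bounded_linear_intro[where K = 1])
    show "q (x + y) = q x + q y" for x y
      by (rule q_eqI) (simp_all add: qV sub q inner_simps)
    show "q (r *\<^sub>R x) = r *\<^sub>R q x" for r x
      by (rule q_eqI) (simp_all add: qV sub q inner_simps)
    show "norm (q x) \<le> norm x * 1" for x
    proof -
      have "norm (q x) * norm (q x) \<le> norm x * norm (q x)"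
        using q[OF qV, of x x] Cauchy_Schwarz_ineq2[of x "q x"]
        by (simp flip: power2_norm_eq_inner add: power2_eq_square)
      then show ?thesis
        by (cases "norm (q x) = 0") (auto simp: mult_le_cancel_right)
    qed
  qed
  then have Q: "blinfun_apply (Blinfun q) = q"
    by (rule bounded_linear_Blinfun_apply)
  \<comment> \<open>Here \<open>V\<close> must be a complex subspace: testing against
    \<open>\<i> *\<^sub>C x\<close> supplies the imaginary part.\<close>
  have cq: "cinner (q a) x = cinner a x" if "x \<in> V" for a x
    by (rule complex_eqI) (simp_all add: Re_cinner Im_cinner q that sub)
  have qq: "q x = x" if "x \<in> V" for x
    by (rule q_eqI) (simp_all add: that)
  have "cinner (q y) x = cinner y (q x)" for x y
    by (metis cq cinner_commute qV)
  then have adj: "adj (Blinfun q) = Blinfun q"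
    by (intro adj_eqI) (simp add: Q)
  have "q (c *\<^sub>C x) = c *\<^sub>C q x" for c x
  proof (rule q_eqI)
    show "inner (c *\<^sub>C q x) z = inner (c *\<^sub>C x) z" if "z \<in> V" for z
      using that by (simp flip: Re_cinner add: cinner_scaleC_left cq)
  qed (simp add: qV sub)
  then have "clin (Blinfun q)"
    by (simp add: clin_def Q)
  moreover have "Blinfun q o\<^sub>L Blinfun q = Blinfun q"
    by (rule blinfun_eqI) (simp add: Q qq qV)
  moreover have "range q = V"
    using qV qq by (metis image_subset_iff rangeI subsetI subset_antisym)
  ultimately show ?thesis
    using adj Q unfolding orth_projection_def by metis
qed

text \<open>Equal ranges give RQ = Q and QR = R, so Q = Q* = (RQ)* = QR = R.\<close>

lemma orth_projection_unique:
  assumes "orth_projection Q" "orth_projection R"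
    and range: "range (blinfun_apply Q) = range (blinfun_apply R)"
  shows "Q = R"
proof (rule blinfun_eqI, rule cinner_extL)
  fix x y
  have QR: "Q (R z) = R z" and RQ: "R (Q z) = Q z" for z
    by (rule orth_projection_fixes_range[OF assms(1)], simp add: range)
      (rule orth_projection_fixes_range[OF assms(2)], simp flip: range)
  have "cinner (Q x) y = cinner (R (Q x)) y"
    by (simp only: RQ)
  also have "\<dots> = cinner x (Q (R y))"
    by (simp only: orth_projection_cinner[OF assms(1)] orth_projection_cinner[OF assms(2)])
  also have "\<dots> = cinner (R x) y"
    by (simp only: QR orth_projection_cinner[OF assms(2)])
  finally show "cinner (Q x) y = cinner (R x) y" .
qed

lemma proj_onto:
  assumes "complex_vector.subspace V" "closed V"
  shows "orth_projection (proj_onto V)" and "range (blinfun_apply (proj_onto V)) = V"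
proof -
  have "\<exists>!Q. orth_projection Q \<and> range (blinfun_apply Q) = V"
    using orth_projection_exists[OF assms] orth_projection_unique by (metis (no_types, lifting))
  from theI'[OF this] show "orth_projection (proj_onto V)"
    and "range (blinfun_apply (proj_onto V)) = V"
    by (simp_all add: proj_onto_def)
qed

text \<open>Polarization at x + y and x + iy. The second is indispensable: a rotation of the real
  plane by a right angle has zero quadratic form.\<close>

lemma clin_eq_zero_if_quadratic_form_zero:
  assumes D: "clin D" and zero: "\<And>x. cinner x (D x) = 0"
  shows "D = 0"
proof (rule blinfun_eqI, rule cinner_extR)
  fix x y
  have "cinner x (D y) + cinner y (D x) = 0"
    using zero[of "x + y"] by (simp add: blinfun.add_right cinner_add_left cinner_add_right zero add.commute)
  moreover have "\<i> * cinner x (D y) - \<i> * cinner y (D x) = 0"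
    using zero[of "x + \<i> *\<^sub>C y"]
    by (simp add: blinfun.add_right cinner_add_left cinner_add_right cinner_scaleC_left
        cinner_scaleC_right zero clinD[OF D])
  ultimately show "cinner x (D y) = cinner x (blinfun_apply 0 y)"
    by (simp add: cinner_zero_right)
qed

text \<open>An operator fixed by compression has the same form at x as at its projection to
  \<open>V\<close>, so agreement on \<open>V\<close> spreads to all vectors and polarization
  applies. This gives uniqueness of P_inf among all operators on M, with no symmetry
  presupposed.\<close>

lemma operator_on_eqI:
  assumes V: "complex_vector.subspace V" "closed V"
    and X: "operator_on V X" and Y: "operator_on V Y"
    and eq: "\<And>y. y \<in> V \<Longrightarrow> cinner y (X y) = cinner y (Y y)"
  shows "X = Y"
proof -
  let ?Q = "proj_onto V"
  note Q = proj_onto[OF V]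
  have form: "cinner x (Z x) = cinner (?Q x) (Z (?Q x))" if "operator_on V Z" for x Z
  proof -
    have "Z x = ?Q (Z (?Q x))"
      using that unfolding operator_on_def compress_def by (metis blinfun_apply_blinfun_compose)
    then show ?thesis
      by (simp add: orth_projection_cinner[OF Q(1)])
  qed
  have "?Q x \<in> V" for x
    using Q(2) by blast
  then have "cinner x ((X - Y) x) = 0" for x
    using eq[of "?Q x"] form[OF X, of x] form[OF Y, of x]
    by (simp add: blinfun.diff_left cinner_diff_right)
  moreover have "clin (X - Y)"
    using X Y by (simp add: operator_on_def clin_diff)
  ultimately have "X - Y = 0"
    by (intro clin_eq_zero_if_quadratic_form_zero)
  then show ?thesis by simp
qed


section \<open>Monotone sequences of operators\<close>

text \<open>For 0 <= D <= I this is D^2 <= D. It turns a small quadratic form into a short vector,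
  hence convergence of forms into strong convergence.\<close>

lemma psd_norm_sq_le:
  fixes D :: "'a::real_inner \<Rightarrow>\<^sub>L 'a"
  assumes sym: "\<And>x y. inner (D x) y = inner x (D y)"
    and pos: "\<And>x. 0 \<le> inner x (D x)"
    and le: "\<And>x. inner x (D x) \<le> (norm x)\<^sup>2"
  shows "(norm (D x))\<^sup>2 \<le> inner x (D x)"
proof -
  \<comment> \<open>positivity at \<open>x - D x\<close> replaces the usual Cauchy-Schwarz argument for the form of \<open>D\<close>\<close>
  have "0 \<le> inner (x - D x) (D (x - D x))"
    by (rule pos)
  also have "\<dots> = inner x (D x) - 2 * (norm (D x))\<^sup>2 + inner (D x) (D (D x))"
    by (simp add: blinfun.diff_right inner_diff_left inner_diff_right power2_norm_eq_inner
        flip: sym[of x "D x"])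
  finally show ?thesis
    using le[of "D x"] by linarith
qed

text \<open>Vigier's theorem. For m <= n the difference X_m - X_n lies between 0 and I, so
  \<open>psd_norm_sq_le\<close> bounds its values by differences of the convergent scalar sequence
  of forms.\<close>

lemma decreasing_strong_limit:
  fixes X :: "nat \<Rightarrow> 'a::{real_inner, complete_space} \<Rightarrow>\<^sub>L 'a"
  assumes sym: "\<And>n x y. inner (X n x) y = inner x (X n y)"
    and dec: "\<And>n x. inner x (X (Suc n) x) \<le> inner x (X n x)"
    and pos: "\<And>n x. 0 \<le> inner x (X n x)"
    and le: "\<And>x. inner x (X 0 x) \<le> (norm x)\<^sup>2"
  shows "\<exists>Y. norm Y \<le> 1 \<and> (\<forall>x. (\<lambda>n. X n x) \<longlonglongrightarrow> blinfun_apply Y x)"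
proof -
  have anti: "decseq (\<lambda>n. inner x (X n x))" for x
    using dec by (simp add: decseq_Suc_iff)
  have le_norm: "inner x (X n x) \<le> (norm x)\<^sup>2" for n x
    using decseqD[OF anti, of 0 n x] le[of x] by linarith
  have diff: "(norm (X m x - X n x))\<^sup>2 \<le> inner x (X m x) - inner x (X n x)" if "m \<le> n" for m n x
  proof -
    have "(norm ((X m - X n) x))\<^sup>2 \<le> inner x ((X m - X n) x)"
    proof (rule psd_norm_sq_le)
      fix z
      show "0 \<le> inner z ((X m - X n) z)" "inner z ((X m - X n) z) \<le> (norm z)\<^sup>2"
        using decseqD[OF anti that, of z] pos[of z n] le_norm[of z m]
        by (simp_all add: blinfun.diff_left inner_diff_right)
    qed (simp add: blinfun.diff_left inner_simps sym)
    then show ?thesis by (simp add: blinfun.diff_left inner_diff_right)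
  qed
  have "Cauchy (\<lambda>n. X n x)" for x
  proof (rule metric_CauchyI)
    fix e :: real assume e: "0 < e"
    have conv: "convergent (\<lambda>n. inner x (X n x))"
      by (rule decseq_convergent[OF anti, of 0 x]) (auto simp: pos convergent_def)
    obtain N where N: "\<And>m n. m \<ge> N \<Longrightarrow> n \<ge> N \<Longrightarrow> dist (inner x (X m x)) (inner x (X n x)) < e\<^sup>2"
      using metric_CauchyD[OF convergent_Cauchy[OF conv], of "e\<^sup>2"] e by auto
    have "dist (X m x) (X n x) < e" if "N \<le> m" "m \<le> n" for m n
    proof -
      have "(norm (X m x - X n x))\<^sup>2 < e\<^sup>2"
        using diff[OF that(2), of x] N[of m n] that by (simp add: dist_real_def)
      then show ?thesis
        using e by (simp add: dist_norm power2_less_imp_less)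
    qed
    then have "dist (X m x) (X n x) < e" if "N \<le> m" "N \<le> n" for m n
      using that by (metis dist_commute nle_le)
    then show "\<exists>N. \<forall>m\<ge>N. \<forall>n\<ge>N. dist (X m x) (X n x) < e" by blast
  qed
  then have "\<forall>x. \<exists>y. (\<lambda>n. X n x) \<longlonglongrightarrow> y"
    by (simp flip: convergent_def add: Cauchy_convergent)
  then obtain f where f: "\<And>x. (\<lambda>n. X n x) \<longlonglongrightarrow> f x"
    by (auto dest!: choice)
  have bound: "norm (f x) \<le> norm x" for x
  proof (rule LIMSEQ_le_const2)
    show "(\<lambda>n. norm (X n x)) \<longlonglongrightarrow> norm (f x)"
      by (intro tendsto_norm f)
    have "(norm (X n x))\<^sup>2 \<le> (norm x)\<^sup>2" for n
      using order_trans[OF psd_norm_sq_le[OF sym pos le_norm] le_norm] .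
    then show "\<exists>N. \<forall>n\<ge>N. norm (X n x) \<le> norm x"
      by (auto intro: power2_le_imp_le)
  qed
  have "bounded_linear f"
  proof (rule bounded_linear_intro[where K = 1])
    show "f (x + y) = f x + f y" for x y
      by (rule LIMSEQ_unique[OF f]) (simp add: blinfun.add_right tendsto_add f)
    show "f (r *\<^sub>R x) = r *\<^sub>R f x" for r x
      by (rule LIMSEQ_unique[OF f]) (simp add: blinfun.scaleR_right tendsto_scaleR f)
  qed (simp add: bound)
  then have "blinfun_apply (Blinfun f) = f"
    by (rule bounded_linear_Blinfun_apply)
  then show ?thesis
    using f bound by (intro exI[of _ "Blinfun f"]) (simp add: norm_blinfun_bound)
qed

lemma clin_strong_limit:
  fixes X :: "nat \<Rightarrow> 'a::chilbert_space \<Rightarrow>\<^sub>L 'b::chilbert_space"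
  assumes "\<And>n. clin (X n)" and "\<And>x. (\<lambda>n. X n x) \<longlonglongrightarrow> blinfun_apply Y x"
  shows "clin Y"
  unfolding clin_def
proof (intro allI LIMSEQ_unique[OF assms(2)])
  show "(\<lambda>n. X n (c *\<^sub>C x)) \<longlonglongrightarrow> c *\<^sub>C Y x" for c x
    using bounded_linear.tendsto[OF bounded_linear_scaleC assms(2)] by (simp add: clinD[OF assms(1)])
qed


section \<open>Words and the Cuntz map\<close>

text \<open>\<open>word_op\<close> recurses at the front of a word while \<open>free_shift\<close>
  appends at the end. The appended letter therefore lands next to the middle operator, which is
  where the Cuntz map acts.\<close>

lemma word_op_snoc: "word_op S (\<alpha> @ [i]) = word_op S \<alpha> o\<^sub>L S i"
  by (induction \<alpha>) (auto intro!: blinfun_eqI)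

lemma clin_word_op: "(\<And>i. clin (S i)) \<Longrightarrow> clin (word_op S \<alpha>)"
  by (induction \<alpha>) (simp_all add: clin_id clin_compose)

lemma cuntz_map_apply: "cuntz_map S X x = (\<Sum>i\<in>UNIV. S i (X (adj (S i) x)))"
  by (simp add: cuntz_map_def blinfun.sum_left)

lemma cinner_cuntz_map:
  assumes "\<And>i. clin (S i)"
  shows "cinner x (cuntz_map S X y) = (\<Sum>i\<in>UNIV. cinner (adj (S i) x) (X (adj (S i) y)))"
  using assms by (simp add: cuntz_map_apply cinner_sum_right cinner_adj_left)

lemma inner_cuntz_map:
  assumes "\<And>i. clin (S i)"
  shows "inner x (cuntz_map S X y) = (\<Sum>i\<in>UNIV. inner (adj (S i) x) (X (adj (S i) y)))"
  using assms by (simp add: cuntz_map_apply inner_sum_right inner_adj_left)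

lemma clin_cuntz_map:
  assumes "\<And>i. clin (S i)" "clin X"
  shows "clin (cuntz_map S X)"
  unfolding cuntz_map_def using assms by (intro clin_sum clin_compose clin_adj)

lemma completely_positive_cuntz_map:
  fixes S :: "'d::finite \<Rightarrow> 'k::chilbert_space \<Rightarrow>\<^sub>L 'k"
  assumes S: "\<And>i. clin (S i)"
  shows "completely_positive (cuntz_map S)"
  unfolding completely_positive_def
proof (intro conjI allI impI)
  fix X :: "'k \<Rightarrow>\<^sub>L 'k" assume "clin X"
  then show "clin (cuntz_map S X)" by (rule clin_cuntz_map[OF S])
next
  fix X Y :: "'k \<Rightarrow>\<^sub>L 'k"
  show "cuntz_map S (X + Y) = cuntz_map S X + cuntz_map S Y"
    by (rule blinfun_eqI)
      (simp add: cuntz_map_apply blinfun.add_left blinfun.add_right sum.distrib)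
next
  fix c y and X Y :: "'k \<Rightarrow>\<^sub>L 'k" assume "\<forall>x. blinfun_apply Y x = c *\<^sub>C X x"
  then show "cuntz_map S Y y = c *\<^sub>C cuntz_map S X y"
    by (simp add: cuntz_map_apply clinD[OF S] complex_vector.scale_sum_right)
next
  fix n :: nat and X :: "nat \<Rightarrow> nat \<Rightarrow> 'k \<Rightarrow>\<^sub>L 'k" and y :: "nat \<Rightarrow> 'k"
  assume pos: "\<forall>x. 0 \<le> (\<Sum>i<n. \<Sum>j<n. cinner (x i) (X i j (x j)))"
  \<comment> \<open>Exchanging sums splits the form into one copy of the form of the matrix
    \<open>X\<close> per letter k, evaluated at the vectors \<open>adj (S k) (y i)\<close>.\<close>
  have "(\<Sum>i<n. \<Sum>j<n. cinner (y i) (cuntz_map S (X i j) (y j)))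
      = (\<Sum>i<n. \<Sum>k\<in>UNIV. \<Sum>j<n. cinner (adj (S k) (y i)) (X i j (adj (S k) (y j))))"
    unfolding cinner_cuntz_map[OF S] by (intro sum.cong refl sum.swap)
  also have "\<dots> = (\<Sum>k\<in>UNIV. \<Sum>i<n. \<Sum>j<n. cinner (adj (S k) (y i)) (X i j (adj (S k) (y j))))"
    by (rule sum.swap)
  finally show "0 \<le> (\<Sum>i<n. \<Sum>j<n. cinner (y i) (cuntz_map S (X i j) (y j)))"
    using pos[rule_format, of "\<lambda>i. adj (S _) (y i)"] by (simp add: sum_nonneg)
qed

lemma free_shift_funpow_dilation:
  assumes S: "\<And>i. clin (S i)"
  shows "(free_shift ^^ N) (\<lambda>\<alpha> \<beta>. adj W o\<^sub>L word_op S \<alpha> o\<^sub>L X o\<^sub>L adj (word_op S \<beta>) o\<^sub>L W)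
    = (\<lambda>\<alpha> \<beta>. adj W o\<^sub>L word_op S \<alpha> o\<^sub>L (cuntz_map S ^^ N) X o\<^sub>L adj (word_op S \<beta>) o\<^sub>L W)"
proof (induction N)
  case (Suc N)
  show ?case
    unfolding funpow.simps o_apply Suc
    by (auto simp: free_shift_def fun_eq_iff word_op_snoc adj_compose clin_word_op S cuntz_map_apply
        blinfun.sum_left blinfun.sum_right intro!: blinfun_eqI)
qed simp

lemma free_shift_funpow_add:
  "(free_shift ^^ N) (\<lambda>\<alpha> \<beta>. K \<alpha> \<beta> + L \<alpha> \<beta>)
    = (\<lambda>\<alpha> \<beta>. (free_shift ^^ N) K \<alpha> \<beta> + (free_shift ^^ N) L \<alpha> \<beta>)"
  by (induction N) (simp_all add: free_shift_def sum.distrib)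

text \<open>The shift is additive, fixes the unitary part, and its iterates send the pure part to
  zero weakly. This recovers \<open>K_unitary\<close> from \<open>K\<close> alone.\<close>

lemma wold_decomposition_limit:
  assumes "wold_decomposition K K_pure K_unitary"
  shows "(\<lambda>N. cinner u ((free_shift ^^ N) K \<alpha> \<beta> v)) \<longlonglongrightarrow> cinner u (K_unitary \<alpha> \<beta> v)"
proof -
  have K: "K = (\<lambda>\<alpha> \<beta>. K_pure \<alpha> \<beta> + K_unitary \<alpha> \<beta>)" and shift_fix: "free_shift K_unitary = K_unitary"
    and pure: "(\<lambda>N. cinner u ((free_shift ^^ N) K_pure \<alpha> \<beta> v)) \<longlonglongrightarrow> 0"
    using assms by (auto simp: wold_decomposition_def)
  have "(free_shift ^^ N) K_unitary = K_unitary" for N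
    by (induction N) (simp_all add: shift_fix)
  then show ?thesis
    using tendsto_add[OF pure tendsto_const[of "cinner u (K_unitary \<alpha> \<beta> v)"]]
    unfolding K free_shift_funpow_add by (simp add: blinfun.add_left cinner_add_right)
qed


section \<open>The cyclic subspace\<close>

lemma csubspace_cyclic_subspace: "complex_vector.subspace (cyclic_subspace S W)"
  unfolding cyclic_subspace_def by (intro csubspace_closure complex_vector.subspace_span)

lemma closed_cyclic_subspace: "closed (cyclic_subspace S W)"
  by (simp add: cyclic_subspace_def)

lemma generator_in_cyclic_subspace: "adj (word_op S \<gamma>) (blinfun_apply W u) \<in> cyclic_subspace S W"
  unfolding cyclic_subspace_def
  by (rule subsetD[OF closure_subset], rule complex_vector.span_base) blast

text \<open>Appending a letter maps generators to generators, as S_i* (S^\<gamma>)* is the adjoint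
  for the word \<gamma>i; the vectors sent into M by S_i* form a closed complex subspace.\<close>

lemma adj_cyclic_subspace:
  assumes S: "\<And>i. clin (S i)" and y: "y \<in> cyclic_subspace S W"
  shows "adj (S i) y \<in> cyclic_subspace S W"
proof -
  let ?M = "cyclic_subspace S W" and ?V = "{y. adj (S i) y \<in> cyclic_subspace S W}"
  note sub = csubspace_cyclic_subspace[of S W]
  have "closed (blinfun_apply (adj (S i)) -` ?M)"
    by (intro closed_vimage closed_cyclic_subspace continuous_intros)
  then have "closed ?V" by (simp add: vimage_def)
  moreover have "complex_vector.subspace ?V"
    using sub
    by (auto simp: complex_vector.subspace_def blinfun.add_right clinD[OF clin_adj[OF S]])
  moreover have "adj (word_op S \<gamma>) (W u) \<in> ?V" for \<gamma> u
    using generator_in_cyclic_subspace[of S "\<gamma> @ [i]" W u] by (simp add: word_op_snoc adj_compose clin_word_op S)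
  ultimately have "?M \<subseteq> ?V"
    unfolding cyclic_subspace_def[of S W]
    by (intro closure_minimal complex_vector.span_minimal) auto
  then show ?thesis using y by blast
qed


text \<open>Well-definedness of P_inf is the unique existence, with convergence stated separately
  because \<open>lim\<close> is total. The universal clause then speaks of that operator; strong
  convergence is that of the compressions.\<close>

theorem corollary5p4:
  fixes M :: "'w measure"
    and A :: "'d::finite \<Rightarrow> 'w \<Rightarrow> 'h::chilbert_space \<Rightarrow>\<^sub>L 'h"
    and K K_pure K_unitary :: "'d list \<Rightarrow> 'd list \<Rightarrow> 'h \<Rightarrow>\<^sub>L 'h"
    and S :: "'d \<Rightarrow> 'k::chilbert_space \<Rightarrow>\<^sub>L 'k"
    and W :: "'h \<Rightarrow>\<^sub>L 'k"
    and P :: "'k \<Rightarrow>\<^sub>L 'k"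
  defines "\<M> \<equiv> cyclic_subspace S W"
    and "T \<equiv> cuntz_map S"
  assumes moment: "moment_kernel M A K"
    and K1_pos: "pos_def_kernel (\<lambda>\<alpha> \<beta>. K \<alpha> \<beta> - free_shift K \<alpha> \<beta>)"
    and wold: "wold_decomposition K K_pure K_unitary"
    and dilation: "minimal_cuntz_dilation K S W P"
  shows "completely_positive T \<and>
    (\<forall>N \<alpha> \<beta>. (free_shift ^^ N) K \<alpha> \<beta>
        = adj W o\<^sub>L word_op S \<alpha> o\<^sub>L (T ^^ N) P o\<^sub>L adj (word_op S \<beta>) o\<^sub>L W) \<and>
    (\<forall>\<alpha> \<beta> u v. (\<lambda>N. cinner u ((free_shift ^^ N) K \<alpha> \<beta> v)) \<longlonglongrightarrow> cinner u (K_unitary \<alpha> \<beta> v)) \<and>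
    (\<forall>y\<in>\<M>. convergent (\<lambda>N. cinner y ((T ^^ N) P y))) \<and>
    (\<exists>!P_inf. operator_on \<M> P_inf \<and>
        (\<forall>y\<in>\<M>. cinner y (P_inf y) = lim (\<lambda>N. cinner y ((T ^^ N) P y)))) \<and>
    (\<forall>P_inf. operator_on \<M> P_inf \<and>
        (\<forall>y\<in>\<M>. cinner y (P_inf y) = lim (\<lambda>N. cinner y ((T ^^ N) P y))) \<longrightarrow>
      (\<forall>y\<in>\<M>. 0 \<le> cinner y (P_inf y)) \<and>
      norm P_inf \<le> 1 \<and>
      (\<forall>y\<in>\<M>. (\<lambda>N. compress \<M> ((T ^^ N) P) y) \<longlonglongrightarrow> P_inf y) \<and>
      (\<forall>\<alpha> \<beta>. K_unitary \<alpha> \<beta>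
          = adj W o\<^sub>L word_op S \<alpha> o\<^sub>L P_inf o\<^sub>L adj (word_op S \<beta>) o\<^sub>L W) \<and>
      (\<forall>\<alpha> \<beta>. K_pure \<alpha> \<beta>
          = adj W o\<^sub>L word_op S \<alpha> o\<^sub>L (P - P_inf) o\<^sub>L adj (word_op S \<beta>) o\<^sub>L W))"
proof -
  let ?X = "\<lambda>N. (T ^^ N) P" and ?Q = "proj_onto \<M>"
  have S: "\<And>i. clin (S i)" and W: "clin W" and P: "orth_projection P"
    and K: "K = (\<lambda>\<alpha> \<beta>. adj W o\<^sub>L word_op S \<alpha> o\<^sub>L P o\<^sub>L adj (word_op S \<beta>) o\<^sub>L W)"
    and TP_le: "\<And>y. y \<in> \<M> \<Longrightarrow> cinner y (T P y) \<le> cinner y (P y)"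
    using dilation
    by (auto simp: minimal_cuntz_dilation_def cuntz_family_def \<M>_def T_def fun_eq_iff)
  have \<M>: "complex_vector.subspace \<M>" "closed \<M>"
    unfolding \<M>_def by (rule csubspace_cyclic_subspace closed_cyclic_subspace)+
  note Q = proj_onto[OF \<M>]
  have Q_in: "?Q x \<in> \<M>" for x
    using Q(2) by blast
  have Q_fix: "?Q x = x" if "x \<in> \<M>" for x
    using orth_projection_fixes_range[OF Q(1)] Q(2) that by simp
  have clin_Q: "clin ?Q"
    using Q(1) by (simp add: orth_projection_def)

  \<comment> \<open>Symmetry, positivity and monotonicity of the iterates\<close>
  have clin_X: "clin (?X N)" for N
    by (induction N) (use P S in \<open>simp_all add: orth_projection_def T_def clin_cuntz_map\<close>)
  have sym: "cinner (?X N x) y = cinner x (?X N y)" for N x y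
  proof (induction N arbitrary: x y)
    case (Suc N)
    have "cinner (?X (Suc N) x) y = cnj (cinner y (T (?X N) x))"
      by (subst cinner_commute) simp
    also have "\<dots> = (\<Sum>i\<in>UNIV. cinner (?X N (adj (S i) x)) (adj (S i) y))"
      by (simp add: T_def cinner_cuntz_map[OF S] flip: cinner_commute)
    also have "\<dots> = cinner x (?X (Suc N) y)"
      by (simp add: Suc.IH) (simp add: T_def cinner_cuntz_map[OF S])
    finally show ?case .
  qed (simp add: orth_projection_cinner[OF P])
  have pos: "0 \<le> inner x (?X N x)" for N x
  proof (induction N arbitrary: x)
    case (Suc N)
    then show ?case
      by (simp add: sum_nonneg) (simp add: T_def inner_cuntz_map[OF S] sum_nonneg)
  qed (simp add: orth_projection_norm_sq[OF P])
  have dec: "inner y (?X (Suc N) y) \<le> inner y (?X N y)" if "y \<in> \<M>" for N y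
    using that
  proof (induction N arbitrary: y)
    case 0
    then show ?case
      using TP_le[of y] by (simp add: less_eq_complex_def Re_cinner)
  next
    case (Suc N)
    have "adj (S i) y \<in> \<M>" for i
      using adj_cyclic_subspace[OF S] Suc.prems unfolding \<M>_def .
    then have "inner y (cuntz_map S (?X (Suc N)) y) \<le> inner y (cuntz_map S (?X N) y)"
      unfolding inner_cuntz_map[OF S] by (intro sum_mono Suc.IH)
    then show ?case by (simp add: T_def)
  qed

  \<comment> \<open>The strong limit on the cyclic subspace\<close>
  have compress_sym: "inner (compress \<M> (?X N) x) y = inner x (compress \<M> (?X N) y)" for N x y
    by (simp add: compress_def orth_projection_inner[OF Q(1)])
      (metis Re_cinner sym orth_projection_cinner[OF Q(1)])
  have compress_form: "inner x (compress \<M> X x) = inner (?Q x) (X (?Q x))" for X x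
    by (simp add: compress_def orth_projection_inner[OF Q(1)])
  \<comment> \<open>An upper bound at index 0 suffices, since the sequence decreases; there the form
    is the squared norm of a vector passed through two projections.\<close>
  have "inner x (compress \<M> (?X 0) x) \<le> (norm x)\<^sup>2" for x
  proof -
    have "norm (P (?Q x)) \<le> norm x"
      using orth_projection_norm_le[OF P] orth_projection_norm_le[OF Q(1)] order_trans by blast
    then show ?thesis
      by (simp add: compress_form orth_projection_norm_sq[OF P])
  qed
  then obtain R where R_norm: "norm R \<le> 1"
    and R: "\<And>x. (\<lambda>N. compress \<M> (?X N) x) \<longlonglongrightarrow> blinfun_apply R x"
    using decreasing_strong_limit[of "\<lambda>N. compress \<M> (?X N)"]
    by (force simp only: compress_sym compress_form dec[OF Q_in] pos)
  have R_clin: "clin R"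
  proof (rule clin_strong_limit[OF _ R])
    show "clin (compress \<M> (?X N))" for N
      unfolding compress_def by (intro clin_compose clin_Q clin_X)
  qed
  \<comment> \<open>Every member of the sequence is fixed by compression, and this passes to strong
    limits.\<close>
  have "compress \<M> R = R"
  proof (rule blinfun_eqI, rule LIMSEQ_unique[OF _ R])
    fix x
    have "(\<lambda>N. ?Q (compress \<M> (?X N) (?Q x))) \<longlonglongrightarrow> ?Q (R (?Q x))"
      by (intro tendsto_intros R)
    then show "(\<lambda>N. compress \<M> (?X N) x) \<longlonglongrightarrow> compress \<M> R x"
      by (simp add: compress_def orth_projection_idem[OF Q(1)])
  qed
  then have R_on: "operator_on \<M> R"
    using R_clin by (simp add: operator_on_def)
  \<comment> \<open>Two different vectors are needed: the kernels pair (S^\<alpha>)* W u with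
    (S^\<beta>)* W v, whereas the definition of P_inf is diagonal.\<close>
  have lim_X: "(\<lambda>N. cinner x (?X N y)) \<longlonglongrightarrow> cinner x (R y)" if "x \<in> \<M>" "y \<in> \<M>" for x y
  proof -
    have "cinner x (compress \<M> (?X N) y) = cinner x (?X N y)" for N
      by (simp add: compress_def Q_fix that flip: orth_projection_cinner[OF Q(1)])
    then show ?thesis
      using tendsto_cinner_right[OF R, of x y] by simp
  qed
  have lim_eq: "lim (\<lambda>N. cinner y (?X N y)) = cinner y (R y)" if "y \<in> \<M>" for y
    using lim_X[OF that that] by (rule limI)
  \<comment> \<open>This collapses both the unique existence and the universal clause to statements
    about \<open>R\<close>.\<close>
  have R_char: "operator_on \<M> Z \<and> (\<forall>y\<in>\<M>. cinner y (Z y) = lim (\<lambda>N. cinner y (?X N y))) \<longleftrightarrow> Z = R"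
    for Z
    using operator_on_eqI[OF \<M> _ R_on] R_on by (auto simp: lim_eq)
  have R_pos: "0 \<le> cinner y (R y)" if "y \<in> \<M>" for y
  proof -
    have "0 \<le> inner y (R y)"
      using tendsto_inner[OF tendsto_const R, of y y]
      by (rule LIMSEQ_le_const) (simp add: compress_form pos)
    \<comment> \<open>The order on complex numbers also requires equal imaginary parts, so the limit
      must be shown to be real.\<close>
    moreover have "cinner y (R y) = cnj (cinner y (R y))"
    proof (rule LIMSEQ_unique[OF lim_X[OF that that]])
      have "(\<lambda>N. cnj (cinner y (?X N y))) = (\<lambda>N. cinner y (?X N y))"
        by (metis cinner_commute sym)
      then show "(\<lambda>N. cinner y (?X N y)) \<longlonglongrightarrow> cnj (cinner y (R y))"
        using tendsto_cnj[OF lim_X[OF that that]] by simp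
    qed
    ultimately show ?thesis
      by (simp add: less_eq_complex_def Re_cinner complex_eq_iff)
  qed

  \<comment> \<open>Transfer to the kernels\<close>
  have shift: "(free_shift ^^ N) K \<alpha> \<beta>
      = adj W o\<^sub>L word_op S \<alpha> o\<^sub>L ?X N o\<^sub>L adj (word_op S \<beta>) o\<^sub>L W" for N \<alpha> \<beta>
    unfolding K free_shift_funpow_dilation[OF S] T_def ..
  have unitary: "K_unitary \<alpha> \<beta> = adj W o\<^sub>L word_op S \<alpha> o\<^sub>L R o\<^sub>L adj (word_op S \<beta>) o\<^sub>L W" for \<alpha> \<beta>
  proof (rule blinfun_eqI, rule cinner_extR)
    fix u v
    have move: "cinner u ((adj W o\<^sub>L word_op S \<alpha> o\<^sub>L X o\<^sub>L adj (word_op S \<beta>) o\<^sub>L W) v)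
        = cinner (adj (word_op S \<alpha>) (W u)) (X (adj (word_op S \<beta>) (W v)))" for X
      by (simp add: cinner_adj_right[OF W] cinner_adj_left clin_word_op S)
    have "(\<lambda>N. cinner u ((free_shift ^^ N) K \<alpha> \<beta> v))
        \<longlonglongrightarrow> cinner (adj (word_op S \<alpha>) (W u)) (R (adj (word_op S \<beta>) (W v)))"
      unfolding shift move
      by (rule lim_X) (simp_all add: \<M>_def generator_in_cyclic_subspace)
    then show "cinner u (K_unitary \<alpha> \<beta> v)
        = cinner u ((adj W o\<^sub>L word_op S \<alpha> o\<^sub>L R o\<^sub>L adj (word_op S \<beta>) o\<^sub>L W) v)"
      unfolding move using wold_decomposition_limit[OF wold] LIMSEQ_unique by blast
  qed
  have pure: "K_pure \<alpha> \<beta> = adj W o\<^sub>L word_op S \<alpha> o\<^sub>L (P - R) o\<^sub>L adj (word_op S \<beta>) o\<^sub>L W" for \<alpha> \<beta>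
  proof -
    have "K_pure \<alpha> \<beta> = K \<alpha> \<beta> - K_unitary \<alpha> \<beta>"
      using wold by (simp add: wold_decomposition_def)
    then show ?thesis
      by (auto simp: unitary K blinfun.diff_left blinfun.diff_right intro!: blinfun_eqI)
  qed

  have cp: "completely_positive T"
    unfolding T_def by (rule completely_positive_cuntz_map[OF S])
  have conv: "convergent (\<lambda>N. cinner y (?X N y))" if "y \<in> \<M>" for y
    using lim_X[OF that that] by (auto simp: convergent_def)
  show ?thesis
    unfolding R_char
    by (intro conjI allI ballI impI)
      (rule cp shift wold_decomposition_limit[OF wold]
        | simp add: conv R_pos R_norm R unitary pure)+
qed

end
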